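(* There is a polynomial-time algorithm which, given a loop-free digraph $D=(V,A)$ with an upper bound $g_{\delta}:V\to\mathbb{Z}_+\cup\{+\infty\}$ on the left-outdegrees and a lower bound $f_{\varrho}:V\to\mathbb{Z}_+\cup\{-\infty\}$ on the right-indegrees, finds an ordering of $V$ such that $\delta^{\ell}(v)\le g_{\delta}(v)$ and $\varrho^{r}(v)\ge f_{\varrho}(v)$ hold for each $v\in V$, or concludes that no such ordering exists.
   Context: Digraphs are finite and loop-free; parallel arcs are allowed (and counted with multiplicity in degrees). $\mathbb{Z}_+$ denotes the nonnegative integers. For an ordering $\sigma=(\sigma_1,\dots,\sigma_n)$ of $V$ and $v=\sigma_i$, the left-outdegree $\delta^{\ell}(v)$ is the number of arcs from $v$ to vertices in $\{\sigma_1,\dots,\sigma_{i-1}\}$, and the right-indegree $\varrho^{r}(v)$ is the number of arcs from vertices in $\{\sigma_{i+1},\dots,\sigma_n\}$ to $v$. *)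

theory Defs
  imports
    "Graph_Theory.Digraph"
    "HOL-Computational_Algebra.Polynomial"
    "HOL-Library.Extended"
    "HOL-Library.Log_Nat"
begin

section \<open>Orderings of the vertex set\<close>

definition is_ordering :: "('v, 'a) pre_digraph \<Rightarrow> 'v list \<Rightarrow> bool" where
  "is_ordering D \<sigma> \<longleftrightarrow> distinct \<sigma> \<and> set \<sigma> = verts D"

definition precedes :: "'v list \<Rightarrow> 'v \<Rightarrow> 'v \<Rightarrow> bool" where
  "precedes \<sigma> u v \<longleftrightarrow> (\<exists>i j. i < j \<and> j < length \<sigma> \<and> \<sigma> ! i = u \<and> \<sigma> ! j = v)"

definition left_outdegree :: "('v, 'a) pre_digraph \<Rightarrow> 'v list \<Rightarrow> 'v \<Rightarrow> nat" where
  "left_outdegree D \<sigma> v = card {e \<in> out_arcs D v. precedes \<sigma> (head D e) v}"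

definition right_indegree :: "('v, 'a) pre_digraph \<Rightarrow> 'v list \<Rightarrow> 'v \<Rightarrow> nat" where
  "right_indegree D \<sigma> v = card {e \<in> in_arcs D v. precedes \<sigma> v (tail D e)}"

definition feasible_ordering ::
  "('v, 'a) pre_digraph \<Rightarrow> ('v \<Rightarrow> nat extended) \<Rightarrow> ('v \<Rightarrow> nat extended) \<Rightarrow> 'v list \<Rightarrow> bool" where
  "feasible_ordering D g f \<sigma> \<longleftrightarrow>
     is_ordering D \<sigma> \<and>
     (\<forall>v \<in> verts D. Fin (left_outdegree D \<sigma> v) \<le> g v \<and> f v \<le> Fin (right_indegree D \<sigma> v))"

section \<open>Random access machines with logarithmic cost\<close>

text \<open>
  The library has no machine model, so polynomial time is defined by a random access machine under
  the logarithmic cost criterion, which is polynomially equivalent to Turing machines. Control flow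
  is structured, and the memory is split into arrays of unbounded length: the state \<open>M\<close> holds the
  number \<open>M k i\<close> in cell \<open>i\<close> of array \<open>k\<close>. A program names array indices \<open>k\<close> only as constants and
  so uses finitely many arrays, whereas addresses \<open>i\<close> are computed.
\<close>

type_synonym memory = "nat \<Rightarrow> nat \<Rightarrow> nat"

datatype aexp = Const nat | Load nat aexp | Plus aexp aexp | Minus aexp aexp

datatype bexp = Less aexp aexp | Not bexp | And bexp bexp

datatype com =
    Skip
  | Store nat aexp aexp
  | Seq com com
  | Cond bexp com com
  | While bexp com

fun aval :: "memory \<Rightarrow> aexp \<Rightarrow> nat" where
  "aval M (Const n) = n"
| "aval M (Load k a) = M k (aval M a)"
| "aval M (Plus a b) = aval M a + aval M b"
| "aval M (Minus a b) = aval M a - aval M b"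

fun bval :: "memory \<Rightarrow> bexp \<Rightarrow> bool" where
  "bval M (Less a b) \<longleftrightarrow> aval M a < aval M b"
| "bval M (Not b) \<longleftrightarrow> \<not> bval M b"
| "bval M (And b c) \<longleftrightarrow> bval M b \<and> bval M c"

text \<open>\<open>floorlog 2 n\<close> is the number of binary digits of \<open>n\<close>, which is \<open>0\<close> for \<open>n = 0\<close>.\<close>

definition bit_size :: "nat \<Rightarrow> nat" where
  "bit_size n = Suc (floorlog 2 n)"

text \<open>
  Every number that occurs during an evaluation is charged its size. In particular, the cost of a
  memory access includes the size of the address, as a part of the cost of evaluating the address.
\<close>

fun acost :: "memory \<Rightarrow> aexp \<Rightarrow> nat" where
  "acost M (Const n) = bit_size n"
| "acost M (Load k a) = acost M a + bit_size (aval M (Load k a))"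
| "acost M (Plus a b) = acost M a + acost M b + bit_size (aval M (Plus a b))"
| "acost M (Minus a b) = acost M a + acost M b + bit_size (aval M (Minus a b))"

fun bcost :: "memory \<Rightarrow> bexp \<Rightarrow> nat" where
  "bcost M (Less a b) = 1 + acost M a + acost M b"
| "bcost M (Not b) = 1 + bcost M b"
| "bcost M (And b c) = 1 + bcost M b + bcost M c"

text \<open>\<open>exec c M t M'\<close>: started in \<open>M\<close>, the program \<open>c\<close> terminates in \<open>M'\<close> at total cost \<open>t\<close>.\<close>

inductive exec :: "com \<Rightarrow> memory \<Rightarrow> nat \<Rightarrow> memory \<Rightarrow> bool" where
  exec_Skip: "exec Skip M 1 M"
| exec_Store:
    "exec (Store k a b) M (1 + acost M a + acost M b) (M(k := (M k)(aval M a := aval M b)))"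
| exec_Seq:
    "exec c M s M' \<Longrightarrow> exec d M' t M'' \<Longrightarrow> exec (Seq c d) M (1 + s + t) M''"
| exec_CondTrue:
    "bval M b \<Longrightarrow> exec c M t M' \<Longrightarrow> exec (Cond b c d) M (1 + bcost M b + t) M'"
| exec_CondFalse:
    "\<not> bval M b \<Longrightarrow> exec d M t M' \<Longrightarrow> exec (Cond b c d) M (1 + bcost M b + t) M'"
| exec_WhileFalse:
    "\<not> bval M b \<Longrightarrow> exec (While b c) M (1 + bcost M b) M"
| exec_WhileTrue:
    "bval M b \<Longrightarrow> exec c M s M' \<Longrightarrow> exec (While b c) M' t M'' \<Longrightarrow>
     exec (While b c) M (1 + bcost M b + s + t) M''"

lemma exec_deterministic:
  "exec c M t M' \<Longrightarrow> exec c M s M'' \<Longrightarrow> s = t \<and> M'' = M'"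
proof (induction arbitrary: s M'' rule: exec.induct)
  case exec_Skip
  then show ?case by (auto elim: exec.cases)
next
  case exec_Store
  then show ?case by (auto elim: exec.cases)
next
  case (exec_Seq c M s1 M1 d t1 M2)
  from exec_Seq.prems show ?case
    by cases (use exec_Seq.IH in blast)
next
  case (exec_CondTrue M b c t M' d)
  from exec_CondTrue.prems show ?case
    by cases (use exec_CondTrue in blast)+
next
  case (exec_CondFalse M b d t M' c)
  from exec_CondFalse.prems show ?case
    by cases (use exec_CondFalse in blast)+
next
  case (exec_WhileFalse M b c)
  from exec_WhileFalse.prems show ?case
    by cases (use exec_WhileFalse in blast)+
next
  case (exec_WhileTrue M b c s1 M1 t1 M2)
  from exec_WhileTrue.prems show ?case
    by cases (use exec_WhileTrue in blast)+
qed

text \<open>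
  Input and output are finite sequences of naturals. The input is supplied in array \<open>0\<close> and the
  output is left in array \<open>1\<close>; in both cases cell \<open>0\<close> holds the length of the sequence and the
  following cells hold its entries. All other cells are initially \<open>0\<close>.
\<close>

definition initial_memory :: "nat list \<Rightarrow> memory" where
  "initial_memory xs =
     (\<lambda>k i. if k = 0 \<and> i \<le> length xs then (length xs # xs) ! i else 0)"

definition result_of :: "memory \<Rightarrow> nat list" where
  "result_of M = map (M 1) [1..<Suc (M 1 0)]"

definition runs :: "com \<Rightarrow> nat list \<Rightarrow> nat \<Rightarrow> nat list \<Rightarrow> bool" where
  "runs P xs t ys \<longleftrightarrow> (\<exists>M. exec P (initial_memory xs) t M \<and> result_of M = ys)"

definition input_size :: "nat list \<Rightarrow> nat" where
  "input_size xs = (\<Sum>x\<leftarrow>xs. bit_size x)"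

section \<open>Encoding of instances\<close>

text \<open>Codes a finite bound \<open>n\<close> by \<open>n + 1\<close> and an infinite one (absent constraint) by \<open>0\<close>.\<close>

fun bound_code :: "nat extended \<Rightarrow> nat" where
  "bound_code (Fin n) = Suc n"
| "bound_code Pinf = 0"
| "bound_code Minf = 0"

text \<open>
  An instance is represented by a listing of the vertices with their bounds and of the arcs with
  their two ends. Vertices are arbitrary naturals, and vertices and arcs may be listed in any order.
  Every arc is listed on its own, so parallel arcs occur as repeated pairs of ends.
\<close>

definition encodes ::
  "nat list \<Rightarrow> (nat, nat) pre_digraph \<Rightarrow> (nat \<Rightarrow> nat extended) \<Rightarrow> (nat \<Rightarrow> nat extended) \<Rightarrow> bool"
where
  "encodes xs D g f \<longleftrightarrow>
     (\<exists>vs as. distinct vs \<and> set vs = verts D \<and> distinct as \<and> set as = arcs D \<and>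
        xs = [length vs, length as] @ vs
             @ map (\<lambda>v. bound_code (g v)) vs @ map (\<lambda>v. bound_code (f v)) vs
             @ map (tail D) as @ map (head D) as)"

end

theory Submission
  imports Defs
begin

text \<open>
  Both constraints at a vertex \<open>v\<close> depend only on the set of vertices to the right of \<open>v\<close>, and both
  become easier when this set grows: there are fewer arcs from \<open>v\<close> to the left of \<open>v\<close>, and more arcs
  from the right of \<open>v\<close> into \<open>v\<close>. Hence an ordering may be built greedily from right to left, each
  time taking any remaining vertex whose constraints hold when it is the last of the remaining ones.
  If no remaining vertex is eligible, then no feasible ordering exists, since in a feasible ordering
  the rightmost of the remaining vertices would be eligible (\<open>feasible_imp_eligible\<close>). Otherwise the
  construction ends with a feasible ordering (\<open>greedy_suffix_feasible\<close>).

  To find eligible vertices, the program sweeps over the list of the \<open>n\<close> vertices \<open>n\<close> times and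
  places every vertex that is eligible when it is visited, which it tests by counting arcs in the
  arc list. A sweep that places nothing shows that no vertex is eligible, so \<open>n\<close> sweeps suffice
  (\<open>sweeps_correct\<close>).

  The running time is bounded by the syntax of the program. Suppose that every number in memory
  has size at most \<open>N\<close>, and that every loop is iterated at most \<open>N\<close> times whenever it is entered.
  Then each evaluation of an expression costs at most a constant times \<open>N\<close>, and the total cost is at
  most the value at \<open>N\<close> of a polynomial defined by recursion on the program (\<open>time_poly\<close>). A Hoare
  logic establishes the two suppositions, with \<open>N\<close> the input size plus \<open>1\<close>, together with the result
  of the program (\<open>ordering_program_triple\<close>).
\<close>

section \<open>The greedy construction from the right\<close>

text \<open>
  The vertex \<open>v\<close> satisfies its constraints if it is put directly to the left of \<open>ps\<close>, with all other
  vertices further left. In a digraph without loops, an arc leaving \<open>v\<close> then goes to the left of \<open>v\<close>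
  if and only if its head is not in \<open>ps\<close>.
\<close>

definition eligible ::
  "('v, 'a) pre_digraph \<Rightarrow> ('v \<Rightarrow> nat extended) \<Rightarrow> ('v \<Rightarrow> nat extended) \<Rightarrow> 'v list \<Rightarrow> 'v \<Rightarrow> bool"
where
  "eligible D g f ps v \<longleftrightarrow> v \<in> verts D \<and> v \<notin> set ps \<and>
     Fin (card {e \<in> out_arcs D v. head D e \<notin> set ps}) \<le> g v \<and>
     f v \<le> Fin (card {e \<in> in_arcs D v. tail D e \<in> set ps})"

text \<open>A list that the greedy construction can produce: each entry was eligible when it was put in
  front of the entries that follow it.\<close>

fun greedy_suffix ::
  "('v, 'a) pre_digraph \<Rightarrow> ('v \<Rightarrow> nat extended) \<Rightarrow> ('v \<Rightarrow> nat extended) \<Rightarrow> 'v list \<Rightarrow> bool"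
where
  "greedy_suffix D g f [] \<longleftrightarrow> True"
| "greedy_suffix D g f (v # ps) \<longleftrightarrow> eligible D g f ps v \<and> greedy_suffix D g f ps"

lemma greedy_suffix_distinct:
  "greedy_suffix D g f ps \<Longrightarrow> distinct ps \<and> set ps \<subseteq> verts D"
  by (induction ps) (auto simp: eligible_def)

lemma greedy_suffix_append:
  "greedy_suffix D g f (qs @ ps) \<Longrightarrow> greedy_suffix D g f ps"
  by (induction qs) auto

lemma precedes_append:
  assumes "distinct (qs @ v # ps)"
  shows "precedes (qs @ v # ps) u v \<longleftrightarrow> u \<in> set qs"
    and "precedes (qs @ v # ps) v u \<longleftrightarrow> u \<in> set ps"
proof -
  let ?s = "qs @ v # ps"
  have pos: "i = length qs" if "i < length ?s" "?s ! i = v" for i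
    using that assms nth_eq_iff_index_eq[OF assms, of i "length qs"] by simp
  show "precedes ?s u v \<longleftrightarrow> u \<in> set qs"
  proof
    assume "precedes ?s u v"
    then obtain i j where "i < j" "j < length ?s" "?s ! i = u" "?s ! j = v"
      unfolding precedes_def by blast
    with pos[of j] show "u \<in> set qs" by (auto simp: nth_append)
  next
    assume "u \<in> set qs"
    then obtain i where "i < length qs" "qs ! i = u" by (auto simp: in_set_conv_nth)
    then show "precedes ?s u v"
      unfolding precedes_def
      by (intro exI[of _ i] exI[of _ "length qs"]) (simp add: nth_append)
  qed
  show "precedes ?s v u \<longleftrightarrow> u \<in> set ps"
  proof
    assume "precedes ?s v u"
    then obtain i j where ij: "i < j" "j < length ?s" "?s ! i = v" "?s ! j = u"
      unfolding precedes_def by blast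
    with pos[of i] have "j > length qs" by auto
    with ij have "u = ps ! (j - Suc (length qs))" "j - Suc (length qs) < length ps"
      by (auto simp: nth_append)
    then show "u \<in> set ps" by auto
  next
    assume "u \<in> set ps"
    then obtain i where "i < length ps" "ps ! i = u" by (auto simp: in_set_conv_nth)
    then show "precedes ?s v u"
      unfolding precedes_def
      by (intro exI[of _ "length qs"] exI[of _ "Suc (length qs + i)"]) (simp add: nth_append)
  qed
qed

lemma greedy_suffix_feasible:
  assumes D: "loopfree_digraph D" and ps: "greedy_suffix D g f ps" and all: "set ps = verts D"
  shows "feasible_ordering D g f ps"
proof -
  interpret loopfree_digraph D by (rule D)
  have dist: "distinct ps" using greedy_suffix_distinct[OF ps] by blast
  have "Fin (left_outdegree D ps v) \<le> g v \<and> f v \<le> Fin (right_indegree D ps v)"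
    if v: "v \<in> verts D" for v
  proof -
    obtain qs rs where split: "ps = qs @ v # rs"
      using v all by (metis split_list)
    have "eligible D g f rs v"
      using greedy_suffix_append[of D g f qs "v # rs"] ps split by simp
    moreover have "{e \<in> out_arcs D v. precedes ps (head D e) v} =
        {e \<in> out_arcs D v. head D e \<notin> set rs}"
    proof -
      have "precedes ps (head D e) v \<longleftrightarrow> head D e \<notin> set rs" if "e \<in> out_arcs D v" for e
      proof -
        have "head D e \<in> set ps" "head D e \<noteq> v"
          using that all no_loops[of e] by auto
        then show ?thesis
          using precedes_append(1)[of qs v rs] dist split by auto
      qed
      then show ?thesis by blast
    qed
    moreover have "{e \<in> in_arcs D v. precedes ps v (tail D e)} =
        {e \<in> in_arcs D v. tail D e \<in> set rs}"
      using precedes_append(2)[of qs v rs] dist split by simp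
    ultimately show ?thesis
      by (simp add: eligible_def left_outdegree_def right_indegree_def)
  qed
  then show ?thesis
    using dist all by (simp add: feasible_ordering_def is_ordering_def)
qed

text \<open>
  The witness is the rightmost vertex of \<open>\<sigma>\<close> outside \<open>ps\<close>: all vertices to its right in \<open>\<sigma>\<close> belong to
  \<open>ps\<close>. Nothing is assumed about how \<open>ps\<close> arose.
\<close>

lemma feasible_imp_eligible:
  assumes D: "fin_digraph D" "loopfree_digraph D" and \<sigma>: "feasible_ordering D g f \<sigma>"
    and rest: "\<not> verts D \<subseteq> set ps"
  shows "\<exists>v. eligible D g f ps v"
proof -
  interpret fin_digraph D by (rule D)
  interpret loopfree_digraph D by (rule D)
  have dist: "distinct \<sigma>" and all: "set \<sigma> = verts D"
    using \<sigma> by (auto simp: feasible_ordering_def is_ordering_def)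
  from rest all have "\<exists>v \<in> set \<sigma>. v \<notin> set ps" by blast
  then obtain qs v rs where split: "\<sigma> = qs @ v # rs"
    and v: "v \<notin> set ps" and rs: "\<forall>u \<in> set rs. u \<in> set ps"
    using split_list_last_prop[of \<sigma> "\<lambda>v. v \<notin> set ps"] by blast
  have bounds: "Fin (left_outdegree D \<sigma> v) \<le> g v" "f v \<le> Fin (right_indegree D \<sigma> v)"
    and vD: "v \<in> verts D"
    using \<sigma> all split by (auto simp: feasible_ordering_def)
  have "card {e \<in> out_arcs D v. head D e \<notin> set ps} \<le> left_outdegree D \<sigma> v"
    unfolding left_outdegree_def
  proof (rule card_mono)
    show "{e \<in> out_arcs D v. head D e \<notin> set ps} \<subseteq> {e \<in> out_arcs D v. precedes \<sigma> (head D e) v}"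
    proof clarify
      fix e assume e: "e \<in> out_arcs D v" "head D e \<notin> set ps"
      then have "head D e \<in> set \<sigma>" "head D e \<noteq> v"
        using all no_loops[of e] by auto
      with e rs show "precedes \<sigma> (head D e) v"
        using precedes_append(1)[of qs v rs] dist split by auto
    qed
  qed simp
  moreover have "right_indegree D \<sigma> v \<le> card {e \<in> in_arcs D v. tail D e \<in> set ps}"
    unfolding right_indegree_def
    by (rule card_mono) (use rs precedes_append(2)[of qs v rs] dist split in auto)
  ultimately show ?thesis
    using bounds v vD unfolding eligible_def
    by (meson less_eq_extended.simps(1) order_trans)
qed

definition prepend_if_eligible ::
  "('v, 'a) pre_digraph \<Rightarrow> ('v \<Rightarrow> nat extended) \<Rightarrow> ('v \<Rightarrow> nat extended) \<Rightarrow> 'v \<Rightarrow> 'v list \<Rightarrow> 'v list"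
where
  "prepend_if_eligible D g f v ps = (if eligible D g f ps v then v # ps else ps)"

lemma prepend_simps [simp]:
  "eligible D g f ps v \<Longrightarrow> prepend_if_eligible D g f v ps = v # ps"
  "\<not> eligible D g f ps v \<Longrightarrow> prepend_if_eligible D g f v ps = ps"
  by (simp_all add: prepend_if_eligible_def)

text \<open>One visit of each vertex in \<open>vs\<close>, starting with the vertices in \<open>ps\<close> already placed.\<close>

abbreviation sweep_list ::
  "('v, 'a) pre_digraph \<Rightarrow> ('v \<Rightarrow> nat extended) \<Rightarrow> ('v \<Rightarrow> nat extended) \<Rightarrow> 'v list \<Rightarrow> 'v list \<Rightarrow> 'v list"
where
  "sweep_list D g f \<equiv> fold (prepend_if_eligible D g f)"

lemma greedy_suffix_sweep:
  "greedy_suffix D g f ps \<Longrightarrow> greedy_suffix D g f (sweep_list D g f vs ps)"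
proof (induction vs arbitrary: ps)
  case (Cons v vs)
  then show ?case by (cases "eligible D g f ps v") auto
qed simp

lemma greedy_suffix_sweeps:
  "greedy_suffix D g f ((sweep_list D g f vs ^^ k) [])"
  by (induction k) (auto intro: greedy_suffix_sweep)

lemma length_sweep_mono: "length ps \<le> length (sweep_list D g f vs ps)"
proof (induction vs arbitrary: ps)
  case (Cons v vs)
  show ?case
    using Cons[of "v # ps"] Cons[of ps] by (cases "eligible D g f ps v") auto
qed simp

lemma length_sweep_less:
  "\<exists>v \<in> set vs. eligible D g f ps v \<Longrightarrow> length ps < length (sweep_list D g f vs ps)"
proof (induction vs arbitrary: ps)
  case (Cons v vs)
  show ?case
  proof (cases "eligible D g f ps v")
    case True
    then show ?thesis
      using length_sweep_mono[of "v # ps" D g f vs] by simp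
  next
    case False
    then show ?thesis using Cons by simp
  qed
qed simp

lemma sweep_stuck:
  "\<forall>v \<in> set vs. \<not> eligible D g f ps v \<Longrightarrow> sweep_list D g f vs ps = ps"
  by (induction vs) auto

text \<open>Each sweep places a vertex unless the construction is stuck, and once stuck it remains so.\<close>

lemma sweeps_progress:
  "k \<le> length ((sweep_list D g f vs ^^ k) []) \<or>
   (\<forall>v \<in> set vs. \<not> eligible D g f ((sweep_list D g f vs ^^ k) []) v)"
proof (induction k)
  case (Suc k)
  let ?ps = "(sweep_list D g f vs ^^ k) []"
  show ?case
  proof (cases "\<exists>v \<in> set vs. eligible D g f ?ps v")
    case True
    then have "k \<le> length ?ps" using Suc by blast
    then show ?thesis using length_sweep_less[OF True] by simp
  next
    case False
    then show ?thesis using sweep_stuck[of vs D g f ?ps] by simp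
  qed
qed simp

lemma sweeps_correct:
  fixes D g f vs
  defines "ps \<equiv> (sweep_list D g f vs ^^ length vs) []"
  assumes D: "fin_digraph D" "loopfree_digraph D" and vs: "distinct vs" "set vs = verts D"
  shows "if length ps = length vs then feasible_ordering D g f ps
         else \<not> (\<exists>\<sigma>. feasible_ordering D g f \<sigma>)"
proof -
  have ps: "greedy_suffix D g f ps"
    unfolding ps_def by (rule greedy_suffix_sweeps)
  have dist: "distinct ps" "set ps \<subseteq> verts D"
    using greedy_suffix_distinct[OF ps] by auto
  have fin: "finite (verts D)" and card: "card (verts D) = length vs"
    using vs distinct_card[of vs] by (auto simp flip: vs(2))
  have card_ps: "card (set ps) = length ps" by (rule distinct_card[OF dist(1)])
  show ?thesis
  proof (cases "length ps = length vs")
    case True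
    then have "set ps = verts D"
      using card_subset_eq[OF fin dist(2)] card card_ps by simp
    then show ?thesis
      using True greedy_suffix_feasible[OF D(2) ps] by simp
  next
    case False
    then have less: "length ps < length vs"
      using card_mono[OF fin dist(2)] card card_ps by simp
    then have "\<forall>v \<in> set vs. \<not> eligible D g f ps v"
      using sweeps_progress[of "length vs" D g f vs] unfolding ps_def by auto
    then have "\<not> (\<exists>v. eligible D g f ps v)"
      using vs by (auto simp: eligible_def)
    moreover have "\<not> verts D \<subseteq> set ps"
      using less card card_ps card_mono[of "set ps" "verts D"] by auto
    ultimately have "\<not> (\<exists>\<sigma>. feasible_ordering D g f \<sigma>)"
      using feasible_imp_eligible[OF D] by blast
    then show ?thesis using False by simp
  qed
qed

section \<open>A Hoare logic with a polynomial time bound\<close>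

lemma bit_size_pos: "0 < bit_size n"
  by (simp add: bit_size_def)

lemma bit_size_mono: "m \<le> n \<Longrightarrow> bit_size m \<le> bit_size n"
  by (simp add: bit_size_def floorlog_mono)

lemma bit_size_le: "bit_size n \<le> Suc n"
proof -
  have "floorlog 2 n \<le> n"
    by (rule floorlog_leI) auto
  then show ?thesis by (simp add: bit_size_def)
qed

text \<open>Crude, but it bounds the size of the value of an expression by a fixed multiple of the largest
  size of a number in memory.\<close>

lemma bit_size_add: "bit_size (m + n) \<le> bit_size m + bit_size n"
proof -
  have "floorlog 2 (m + n) \<le> Suc (max (floorlog 2 m) (floorlog 2 n))" (is "_ \<le> Suc ?k")
  proof (rule floorlog_leI)
    have less: "x < 2 ^ floorlog 2 x" for x :: nat
      by (cases "x = 0") (use floorlog_bounds[of x 2] in auto)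
    have "m < 2 ^ ?k" "n < 2 ^ ?k"
      by (rule less_le_trans[OF less power_increasing]; simp)+
    then show "m + n < 2 ^ Suc ?k" by simp
  qed auto
  then show ?thesis by (simp add: bit_size_def)
qed

lemma length_le_input_size: "length ys \<le> input_size ys"
proof (induction ys)
  case (Cons y ys)
  then show ?case using bit_size_pos[of y] by (simp add: input_size_def)
qed (simp add: input_size_def)

text \<open>All cells hold numbers of size at most \<open>N\<close>.\<close>

definition mem_bounded :: "nat \<Rightarrow> memory \<Rightarrow> bool" where
  "mem_bounded N M \<longleftrightarrow> (\<forall>k i. bit_size (M k i) \<le> N)"

lemma mem_bounded_update:
  "mem_bounded N M \<Longrightarrow> bit_size v \<le> N \<Longrightarrow> mem_bounded N (M(k := (M k)(i := v)))"
  by (simp add: mem_bounded_def)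

lemma mem_bounded_pos: "mem_bounded N M \<Longrightarrow> 0 < N"
  unfolding mem_bounded_def using bit_size_pos by (metis less_le_trans)

text \<open>
  In a memory bounded by \<open>N\<close>, the size of the value of \<open>a\<close> is at most \<open>value_weight a * N\<close>, and the
  cost of an evaluation is at most \<open>acost_weight a * N\<close> or \<open>bcost_weight b * N\<close>.
\<close>

fun value_weight :: "aexp \<Rightarrow> nat" where
  "value_weight (Const n) = bit_size n"
| "value_weight (Load k a) = 1"
| "value_weight (Plus a b) = value_weight a + value_weight b"
| "value_weight (Minus a b) = value_weight a"

fun acost_weight :: "aexp \<Rightarrow> nat" where
  "acost_weight (Const n) = bit_size n"
| "acost_weight (Load k a) = acost_weight a + 1"
| "acost_weight (Plus a b) = acost_weight a + acost_weight b + value_weight (Plus a b)"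
| "acost_weight (Minus a b) = acost_weight a + acost_weight b + value_weight (Minus a b)"

fun bcost_weight :: "bexp \<Rightarrow> nat" where
  "bcost_weight (Less a b) = 1 + acost_weight a + acost_weight b"
| "bcost_weight (Not b) = 1 + bcost_weight b"
| "bcost_weight (And b c) = 1 + bcost_weight b + bcost_weight c"

lemma bit_size_aval:
  assumes "mem_bounded N M"
  shows "bit_size (aval M a) \<le> value_weight a * N"
proof (induction a)
  case (Const n)
  then show ?case using mem_bounded_pos[OF assms] by simp
next
  case (Load k a)
  then show ?case using assms by (simp add: mem_bounded_def)
next
  case (Plus a b)
  then show ?case
    using bit_size_add[of "aval M a" "aval M b"] by (simp add: add_mult_distrib)
next
  case (Minus a b)
  then show ?case
    using bit_size_mono[of "aval M a - aval M b" "aval M a"] by simp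
qed

lemma acost_le:
  assumes "mem_bounded N M"
  shows "acost M a \<le> acost_weight a * N"
proof (induction a)
  case (Const n)
  then show ?case using mem_bounded_pos[OF assms] by simp
next
  case (Load k a)
  then show ?case using bit_size_aval[OF assms, of "Load k a"] by simp
next
  case (Plus a b)
  then show ?case
    using bit_size_aval[OF assms, of "Plus a b"] by (simp add: add_mult_distrib)
next
  case (Minus a b)
  then show ?case
    using bit_size_aval[OF assms, of "Minus a b"] by (simp add: add_mult_distrib)
qed

lemma bcost_le:
  assumes "mem_bounded N M"
  shows "bcost M b \<le> bcost_weight b * N"
proof (induction b)
  case (Less a b)
  then show ?case
    using acost_le[OF assms, of a] acost_le[OF assms, of b] mem_bounded_pos[OF assms]
    by (simp add: add_mult_distrib)
qed (use mem_bounded_pos[OF assms] in \<open>simp_all add: add_mult_distrib\<close>)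

text \<open>
  A polynomial bound on the cost of a program in terms of \<open>N\<close>, valid if the memory stays bounded by
  \<open>N\<close> and no loop is iterated more than \<open>N\<close> times. The factor \<open>N + 1\<close> for a loop includes the last
  evaluation of its guard, and both branches of a conditional are charged.
\<close>

fun time_poly :: "com \<Rightarrow> nat poly" where
  "time_poly Skip = 1"
| "time_poly (Store k a b) = [:1, acost_weight a + acost_weight b:]"
| "time_poly (Seq c d) = 1 + time_poly c + time_poly d"
| "time_poly (Cond b c d) = [:1, bcost_weight b:] + time_poly c + time_poly d"
| "time_poly (While b c) = [:1, 1:] * ([:1, bcost_weight b:] + time_poly c)"

text \<open>
  Total correctness within the time bound. Boundedness of the memory is built into the triple, as an
  additional precondition and postcondition.
\<close>

definition triple :: "nat \<Rightarrow> (memory \<Rightarrow> bool) \<Rightarrow> com \<Rightarrow> (memory \<Rightarrow> bool) \<Rightarrow> bool" where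
  "triple N P c Q \<longleftrightarrow> (\<forall>M. mem_bounded N M \<longrightarrow> P M \<longrightarrow>
     (\<exists>t M'. exec c M t M' \<and> t \<le> poly (time_poly c) N \<and> mem_bounded N M' \<and> Q M'))"

lemma tripleD:
  "triple N P c Q \<Longrightarrow> mem_bounded N M \<Longrightarrow> P M \<Longrightarrow>
   \<exists>t M'. exec c M t M' \<and> t \<le> poly (time_poly c) N \<and> mem_bounded N M' \<and> Q M'"
  unfolding triple_def by blast

lemma triple_pre:
  "triple N P c Q \<Longrightarrow> (\<And>M. mem_bounded N M \<Longrightarrow> P' M \<Longrightarrow> P M) \<Longrightarrow> triple N P' c Q"
  unfolding triple_def by blast

lemma triple_Skip: "triple N Q Skip Q"
  unfolding triple_def using exec_Skip by fastforce

lemma triple_Store: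
  "triple N (\<lambda>M. bit_size (aval M b) \<le> N \<and> Q (M(k := (M k)(aval M a := aval M b))))
     (Store k a b) Q"
  unfolding triple_def
proof (intro allI impI, elim conjE)
  fix M assume M: "mem_bounded N M" "bit_size (aval M b) \<le> N"
    and Q: "Q (M(k := (M k)(aval M a := aval M b)))"
  have "1 + acost M a + acost M b \<le> poly (time_poly (Store k a b)) N"
    using acost_le[OF M(1), of a] acost_le[OF M(1), of b]
    by (simp add: algebra_simps)
  then show "\<exists>t M'. exec (Store k a b) M t M' \<and> t \<le> poly (time_poly (Store k a b)) N \<and>
      mem_bounded N M' \<and> Q M'"
    using exec_Store mem_bounded_update[OF M] Q by blast
qed

lemma triple_Seq:
  assumes "triple N R d Q" "triple N P c R"
  shows "triple N P (Seq c d) Q"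
  unfolding triple_def
proof (intro allI impI)
  fix M assume "mem_bounded N M" "P M"
  then obtain s M' where 1: "exec c M s M'" "s \<le> poly (time_poly c) N"
    "mem_bounded N M'" "R M'" using tripleD[OF assms(2)] by blast
  from tripleD[OF assms(1), OF 1(3,4)] obtain t M''
    where 2: "exec d M' t M''" "t \<le> poly (time_poly d) N" "mem_bounded N M''" "Q M''" by blast
  have "1 + s + t \<le> poly (time_poly (Seq c d)) N" using 1(2) 2(2) by simp
  with exec_Seq[OF 1(1) 2(1)] 2(3,4)
  show "\<exists>t M'. exec (Seq c d) M t M' \<and> t \<le> poly (time_poly (Seq c d)) N \<and>
      mem_bounded N M' \<and> Q M'" by blast
qed

lemma triple_Cond:
  assumes "triple N P1 c Q" "triple N P2 d Q"
  shows "triple N (\<lambda>M. if bval M b then P1 M else P2 M) (Cond b c d) Q"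
  unfolding triple_def
proof (intro allI impI)
  fix M assume M: "mem_bounded N M" and P: "if bval M b then P1 M else P2 M"
  note cost = bcost_le[OF M, of b]
  show "\<exists>t M'. exec (Cond b c d) M t M' \<and> t \<le> poly (time_poly (Cond b c d)) N \<and>
      mem_bounded N M' \<and> Q M'"
  proof (cases "bval M b")
    case True
    with P have "P1 M" by simp
    from tripleD[OF assms(1), OF M this] obtain t M'
      where 1: "exec c M t M'" "t \<le> poly (time_poly c) N" "mem_bounded N M'" "Q M'" by blast
    have "1 + bcost M b + t \<le> poly (time_poly (Cond b c d)) N"
      using 1(2) cost by (simp add: mult.commute)
    with exec_CondTrue[OF True 1(1)] 1(3,4) show ?thesis by blast
  next
    case False
    with P have "P2 M" by simp
    from tripleD[OF assms(2), OF M this] obtain t M'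
      where 1: "exec d M t M'" "t \<le> poly (time_poly d) N" "mem_bounded N M'" "Q M'" by blast
    have "1 + bcost M b + t \<le> poly (time_poly (Cond b c d)) N"
      using 1(2) cost by (simp add: mult.commute)
    with exec_CondFalse[OF False 1(1)] 1(3,4) show ?thesis by blast
  qed
qed

text \<open>
  A precondition of a loop-free program for the postcondition \<open>Q\<close>, by which simplification can verify
  such programs. The value \<open>False\<close> for loops only makes the function total.
\<close>

fun wp :: "nat \<Rightarrow> com \<Rightarrow> (memory \<Rightarrow> bool) \<Rightarrow> memory \<Rightarrow> bool" where
  "wp N Skip Q M \<longleftrightarrow> Q M"
| "wp N (Store k a b) Q M \<longleftrightarrow>
     bit_size (aval M b) \<le> N \<and> Q (M(k := (M k)(aval M a := aval M b)))"
| "wp N (Seq c d) Q M \<longleftrightarrow> wp N c (wp N d Q) M"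
| "wp N (Cond b c d) Q M \<longleftrightarrow> (if bval M b then wp N c Q M else wp N d Q M)"
| "wp N (While b c) Q M \<longleftrightarrow> False"

lemma triple_wp: "triple N (wp N c Q) c Q"
proof (induction c arbitrary: Q)
  case Skip
  show ?case by (rule triple_pre[OF triple_Skip]) simp
next
  case (Store k a b)
  show ?case by (rule triple_pre[OF triple_Store]) (simp add: fun_upd_def)
next
  case (Seq c d)
  show ?case by (rule triple_pre[OF triple_Seq[OF Seq.IH(2) Seq.IH(1)]]) simp
next
  case (Cond b c d)
  show ?case by (rule triple_pre[OF triple_Cond[OF Cond.IH]]) (simp split: if_splits)
next
  case (While b c)
  show ?case by (simp add: triple_def)
qed

lemma triple_straight:
  "(\<And>M. mem_bounded N M \<Longrightarrow> P M \<Longrightarrow> wp N c Q M) \<Longrightarrow> triple N P c Q"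
  using triple_pre[OF triple_wp] .

text \<open>The loop rule is restricted to loops whose number of iterations \<open>K\<close> is known in advance; the
  invariant \<open>I k\<close> describes the memory after \<open>k\<close> iterations.\<close>

lemma triple_While:
  assumes guard: "\<And>k M. I k M \<Longrightarrow> bval M b \<longleftrightarrow> k < K"
    and body: "\<And>k. k < K \<Longrightarrow> triple N (I k) c (I (Suc k))"
    and iterations: "K \<le> N"
  shows "triple N (I 0) (While b c) (I K)"
proof -
  let ?T = "1 + bcost_weight b * N + poly (time_poly c) N"
  have loop: "\<exists>t M'. exec (While b c) M t M' \<and> t \<le> Suc (K - k) * ?T \<and> mem_bounded N M' \<and> I K M'"
    if "k \<le> K" "mem_bounded N M" "I k M" for k M
    using that
  proof (induction arbitrary: M rule: inc_induct)
    case base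
    then have "\<not> bval M b" using guard by blast
    then have "exec (While b c) M (1 + bcost M b) M" by (rule exec_WhileFalse)
    with bcost_le[OF base(1), of b] base show ?case by fastforce
  next
    case (step k)
    then have b: "bval M b" using guard by blast
    from tripleD[OF body[OF step.hyps(2)], OF step.prems] obtain s M' where
      1: "exec c M s M'" "s \<le> poly (time_poly c) N" "mem_bounded N M'" "I (Suc k) M'"
      by blast
    from step.IH[OF 1(3,4)] obtain t M'' where
      2: "exec (While b c) M' t M''" "t \<le> Suc (K - Suc k) * ?T" "mem_bounded N M''" "I K M''"
      by blast
    have "1 + bcost M b + s + t \<le> ?T + Suc (K - Suc k) * ?T"
      using 1(2) 2(2) bcost_le[OF step.prems(1), of b] by linarith
    also have "\<dots> = Suc (K - k) * ?T"
      by (simp only: mult_Suc Suc_diff_Suc[OF step.hyps(2)])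
    finally show ?case using exec_WhileTrue[OF b 1(1) 2(1)] 2(3,4) by blast
  qed
  show ?thesis
    unfolding triple_def
  proof (intro allI impI)
    fix M assume "mem_bounded N M" "I 0 M"
    with loop[of 0 M] obtain t M' where
      1: "exec (While b c) M t M'" "t \<le> Suc K * ?T" "mem_bounded N M'" "I K M'" by auto
    have "Suc K * ?T \<le> Suc N * ?T" using iterations by (intro mult_right_mono) auto
    also have "\<dots> = poly (time_poly (While b c)) N" by (simp add: algebra_simps)
    finally have "t \<le> poly (time_poly (While b c)) N" using 1(2) by linarith
    then show "\<exists>t M'. exec (While b c) M t M' \<and> t \<le> poly (time_poly (While b c)) N \<and>
        mem_bounded N M' \<and> I K M'" using 1 by blast
  qed
qed

section \<open>The program\<close>

definition Equal :: "aexp \<Rightarrow> aexp \<Rightarrow> bexp" where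
  "Equal a b = And (Not (Less a b)) (Not (Less b a))"

lemma bval_Equal [simp]: "bval M (Equal a b) \<longleftrightarrow> aval M a = aval M b"
  by (auto simp: Equal_def)

text \<open>
  Array \<open>0\<close> holds the input and array \<open>1\<close> receives the output. Cell \<open>v\<close> of array \<open>2\<close> is \<open>1\<close> if the vertex
  \<open>v\<close> has been placed, and \<open>0\<close> otherwise. The other arrays are used as single variables: the number of
  vertices not yet placed, the index of the current sweep, the positions in the vertex list and in
  the arc list, and the two counts of arcs at the current vertex.
\<close>

abbreviation "n_exp \<equiv> Load 0 (Const 1)"
abbreviation "m_exp \<equiv> Load 0 (Const 2)"
abbreviation "rest_exp \<equiv> Load 3 (Const 0)"
abbreviation "k_exp \<equiv> Load 4 (Const 0)"
abbreviation "j_exp \<equiv> Load 5 (Const 0)"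
abbreviation "e_exp \<equiv> Load 6 (Const 0)"
abbreviation "out_exp \<equiv> Load 7 (Const 0)"
abbreviation "in_exp \<equiv> Load 8 (Const 0)"

text \<open>
  The ends of the current arc, and the current vertex with its coded bounds. The input list starts
  in cell \<open>1\<close> with the numbers of vertices and arcs, so the vertices start in cell \<open>3\<close>.
\<close>

definition vertex_exp :: aexp where
  "vertex_exp = Load 0 (Plus (Const 3) j_exp)"

definition g_exp :: aexp where
  "g_exp = Load 0 (Plus (Plus (Const 3) n_exp) j_exp)"

definition f_exp :: aexp where
  "f_exp = Load 0 (Plus (Plus (Plus (Const 3) n_exp) n_exp) j_exp)"

definition tail_exp :: aexp where
  "tail_exp = Load 0 (Plus (Plus (Plus (Plus (Const 3) n_exp) n_exp) n_exp) e_exp)"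

definition head_exp :: aexp where
  "head_exp = Load 0 (Plus (Plus (Plus (Plus (Plus (Const 3) n_exp) n_exp) n_exp) m_exp) e_exp)"

text \<open>Counts the current arc if it leaves the current vertex towards a vertex not yet placed, or
  enters it from a placed one.\<close>

definition scan_arc :: com where
  "scan_arc =
     Seq (Cond (And (Equal tail_exp vertex_exp) (Less (Load 2 head_exp) (Const 1)))
            (Store 7 (Const 0) (Plus out_exp (Const 1))) Skip)
    (Seq (Cond (And (Equal head_exp vertex_exp) (Less (Const 0) (Load 2 tail_exp)))
            (Store 8 (Const 0) (Plus in_exp (Const 1))) Skip)
         (Store 6 (Const 0) (Plus e_exp (Const 1))))"

definition count_arcs :: com where
  "count_arcs =
     Seq (Seq (Store 6 (Const 0) (Const 0))
         (Seq (Store 7 (Const 0) (Const 0))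
              (Store 8 (Const 0) (Const 0))))
         (While (Less e_exp m_exp) scan_arc)"

text \<open>
  Cell \<open>1\<close> of the output array is reserved for the answer, so \<open>r\<close> remaining vertices belong in
  cells \<open>2\<close> to \<open>r + 1\<close>.
\<close>

definition place_vertex :: com where
  "place_vertex =
     Seq (Store 1 (Plus rest_exp (Const 1)) vertex_exp)
    (Seq (Store 2 vertex_exp (Const 1))
         (Store 3 (Const 0) (Minus rest_exp (Const 1))))"

text \<open>
  A finite bound \<open>b\<close> is coded by \<open>b + 1\<close>. Thus the upper bound is violated if its code is positive and
  at most the count, and the lower bound is satisfied if its code is less than the count plus \<open>2\<close>;
  the code \<open>0\<close> of an absent lower bound passes this test.
\<close>

definition eligible_test :: bexp where
  "eligible_test =
     And (Less (Load 2 vertex_exp) (Const 1))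
    (And (Not (And (Less (Const 0) g_exp) (Not (Less out_exp g_exp))))
         (Less f_exp (Plus in_exp (Const 2))))"

definition visit_vertex :: com where
  "visit_vertex =
     Seq count_arcs
    (Seq (Cond eligible_test place_vertex Skip)
         (Store 5 (Const 0) (Plus j_exp (Const 1))))"

definition sweep :: com where
  "sweep =
     Seq (Seq (Store 5 (Const 0) (Const 0))
              (While (Less j_exp n_exp) visit_vertex))
         (Store 4 (Const 0) (Plus k_exp (Const 1)))"

definition write_answer :: com where
  "write_answer =
     Cond (Less rest_exp (Const 1))
       (Seq (Store 1 (Const 0) (Plus n_exp (Const 1))) (Store 1 (Const 1) (Const 1)))
       (Seq (Store 1 (Const 0) (Const 1)) (Store 1 (Const 1) (Const 0)))"

text \<open>The sweep index needs no initialization, since all cells outside the input are initially \<open>0\<close>.\<close>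

definition ordering_program :: com where
  "ordering_program =
     Seq (Seq (Store 3 (Const 0) n_exp) (While (Less k_exp n_exp) sweep))
         write_answer"

section \<open>Correctness of the program\<close>

text \<open>An instance together with the listings \<open>vs\<close> and \<open>as\<close> of its vertices and arcs that determine the
  input list.\<close>

locale encoded_instance =
  fixes D :: "(nat, nat) pre_digraph" and g f :: "nat \<Rightarrow> nat extended" and vs as :: "nat list"
  assumes finD: "fin_digraph D" and loopfreeD: "loopfree_digraph D"
    and g: "v \<in> verts D \<Longrightarrow> g v \<noteq> Minf" and f: "v \<in> verts D \<Longrightarrow> f v \<noteq> Pinf"
    and vs: "distinct vs" "set vs = verts D" and as: "distinct as" "set as = arcs D"
begin

abbreviation "n \<equiv> length vs"
abbreviation "m \<equiv> length as"

definition xs :: "nat list" where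
  "xs = [n, m] @ vs @ map (\<lambda>v. bound_code (g v)) vs @ map (\<lambda>v. bound_code (f v)) vs
         @ map (tail D) as @ map (head D) as"

text \<open>
  Entries of \<open>xs\<close> have size at most \<open>input_size xs\<close>. The other numbers in memory are at most
  \<open>length xs\<close>, which is at most \<open>input_size xs\<close>; since a number \<open>i\<close> has size at most \<open>i + 1\<close>, the
  bound \<open>N\<close> applies to them as well.
\<close>

definition N :: nat where
  "N = input_size xs + 1"

lemma length_xs: "length xs = 2 + 3 * n + 2 * m"
  by (simp add: xs_def)

lemma n_le: "n \<le> N" and m_le: "m \<le> N"
  using length_le_input_size[of xs] by (auto simp: N_def length_xs)

lemma bit_size_small: "i \<le> n \<or> i \<le> m \<or> i \<le> 1 \<or> i = Suc n \<Longrightarrow> bit_size i \<le> N"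
  using bit_size_le[of i] length_le_input_size[of xs] by (auto simp: N_def length_xs)

abbreviation input :: "nat \<Rightarrow> nat" where
  "input \<equiv> initial_memory xs 0"

lemma input_Suc: "i < length xs \<Longrightarrow> input (Suc i) = xs ! i"
  by (simp add: initial_memory_def)

lemma input_layout:
  "input (Suc 0) = n" "input 2 = m"
  "j < n \<Longrightarrow> input (3 + j) = vs ! j"
  "j < n \<Longrightarrow> input (3 + n + j) = bound_code (g (vs ! j))"
  "j < n \<Longrightarrow> input (3 + n + n + j) = bound_code (f (vs ! j))"
  "e < m \<Longrightarrow> input (3 + n + n + n + e) = tail D (as ! e)"
  "e < m \<Longrightarrow> input (3 + n + n + n + m + e) = head D (as ! e)"
proof -
  have *: "input (3 + i) = drop 2 xs ! i" if "i < 3 * n + 2 * m" for i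
  proof -
    have "input (Suc (2 + i)) = xs ! (2 + i)"
      using that by (intro input_Suc) (simp add: length_xs)
    moreover have "Suc (2 + i) = 3 + i" by simp
    moreover have "drop 2 xs ! i = xs ! (2 + i)"
      by (rule nth_drop) (simp add: length_xs)
    ultimately show ?thesis by metis
  qed
  have "input (Suc 0) = xs ! 0" "input (Suc (Suc 0)) = xs ! Suc 0"
    by (rule input_Suc, simp add: length_xs)+
  then show "input (Suc 0) = n" "input 2 = m"
    by (simp_all add: xs_def numeral_2_eq_2)
  show "input (3 + j) = vs ! j" if "j < n"
    using *[of j] that by (simp add: xs_def nth_append)
  show "input (3 + n + j) = bound_code (g (vs ! j))" if "j < n"
    using *[of "n + j"] that by (simp add: xs_def nth_append add.assoc)
  show "input (3 + n + n + j) = bound_code (f (vs ! j))" if "j < n"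
    using *[of "n + n + j"] that by (simp add: xs_def nth_append add.assoc)
  show "input (3 + n + n + n + e) = tail D (as ! e)" if "e < m"
    using *[of "n + n + n + e"] that by (simp add: xs_def nth_append add.assoc)
  show "input (3 + n + n + n + m + e) = head D (as ! e)" if "e < m"
    using *[of "n + n + n + m + e"] that by (simp add: xs_def nth_append add.assoc)
qed

text \<open>The address arithmetic is resolved here once and for all, because the simplifier would otherwise
  rearrange the sums that \<open>input_layout\<close> refers to.\<close>

declare input_layout(1,2) [simp]

lemma aval_input [simp]:
  assumes "M 0 = input"
  shows "aval M n_exp = n" "aval M m_exp = m"
    and "M 5 0 < n \<Longrightarrow> aval M vertex_exp = vs ! (M 5 0)"
    and "M 5 0 < n \<Longrightarrow> aval M g_exp = bound_code (g (vs ! (M 5 0)))"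
    and "M 5 0 < n \<Longrightarrow> aval M f_exp = bound_code (f (vs ! (M 5 0)))"
    and "M 6 0 < m \<Longrightarrow> aval M tail_exp = tail D (as ! (M 6 0))"
    and "M 6 0 < m \<Longrightarrow> aval M head_exp = head D (as ! (M 6 0))"
  by (simp_all only: vertex_exp_def g_exp_def f_exp_def tail_exp_def head_exp_def
      aval.simps assms input_layout One_nat_def)

lemma mem_bounded_initial: "mem_bounded N (initial_memory xs)"
proof -
  have *: "bit_size x \<le> input_size ys" if "x \<in> set ys" for x ys
    using that by (induction ys) (auto simp: input_size_def)
  have "bit_size (length xs) \<le> N"
    using bit_size_le[of "length xs"] length_le_input_size[of xs] by (simp add: N_def)
  moreover have "bit_size 0 \<le> N" by (rule bit_size_small) simp
  moreover have "bit_size (xs ! i) \<le> N" if "i < length xs" for i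
    using *[of "xs ! i" xs] that by (simp add: N_def)
  ultimately show ?thesis
    by (auto simp: mem_bounded_def initial_memory_def nth_Cons split: nat.split)
qed

text \<open>The placed vertices \<open>ps\<close> occupy the right end of the block of cells \<open>2\<close> to \<open>n + 1\<close>.\<close>

definition output_block :: "nat list \<Rightarrow> (nat \<Rightarrow> nat) \<Rightarrow> bool" where
  "output_block ps B \<longleftrightarrow> (\<forall>i < length ps. B (n + 2 - length ps + i) = ps ! i)"

lemma output_block_Nil [simp]: "output_block [] B"
  by (simp add: output_block_def)

lemma output_block_Cons:
  assumes "output_block ps B" "length ps < n"
  shows "output_block (v # ps) (B(Suc (n - length ps) := v))"
  unfolding output_block_def
proof (intro allI impI)
  fix i assume i: "i < length (v # ps)"
  show "(B(Suc (n - length ps) := v)) (n + 2 - length (v # ps) + i) = (v # ps) ! i"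
  proof (cases i)
    case 0
    then show ?thesis using assms(2) by (simp add: Suc_diff_le)
  next
    case (Suc i')
    then have "n + 2 - length (v # ps) + i = n + 2 - length ps + i'"
      and "n + 2 - length ps + i' \<noteq> Suc (n - length ps)"
      using assms(2) by auto
    then show ?thesis
      using assms(1) i Suc by (simp only: output_block_def) simp
  qed
qed

text \<open>The vertices \<open>ps\<close> have been placed, the sweep index is \<open>k\<close>, and the position in the vertex list
  is \<open>j\<close>.\<close>

definition state :: "nat list \<Rightarrow> nat \<Rightarrow> nat \<Rightarrow> memory \<Rightarrow> bool" where
  "state ps k j M \<longleftrightarrow> M 0 = input \<and> M 2 = (\<lambda>v. if v \<in> set ps then 1 else 0) \<and>
     M 3 0 = n - length ps \<and> M 4 0 = k \<and> M 5 0 = j \<and> output_block ps (M 1)"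

text \<open>The two degrees in the definition of eligibility, restricted to the arcs listed in \<open>es\<close>.\<close>

definition out_count :: "nat list \<Rightarrow> nat \<Rightarrow> nat list \<Rightarrow> nat" where
  "out_count ps v es = length (filter (\<lambda>e. tail D e = v \<and> head D e \<notin> set ps) es)"

definition in_count :: "nat list \<Rightarrow> nat \<Rightarrow> nat list \<Rightarrow> nat" where
  "in_count ps v es = length (filter (\<lambda>e. head D e = v \<and> tail D e \<in> set ps) es)"

text \<open>In addition, the first \<open>e\<close> arcs have been counted for the current vertex.\<close>

definition arc_state :: "nat list \<Rightarrow> nat \<Rightarrow> nat \<Rightarrow> nat \<Rightarrow> memory \<Rightarrow> bool" where
  "arc_state ps k j e M \<longleftrightarrow> state ps k j M \<and> M 6 0 = e \<and>
     M 7 0 = out_count ps (vs ! j) (take e as) \<and> M 8 0 = in_count ps (vs ! j) (take e as)"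

lemma count_le: "out_count ps v (take e as) \<le> m" "in_count ps v (take e as) \<le> m"
  unfolding out_count_def in_count_def
  by (rule order_trans[OF length_filter_le], simp)+

lemma count_Suc:
  assumes "e < m"
  shows "out_count ps v (take (Suc e) as) = out_count ps v (take e as) +
           (if tail D (as ! e) = v \<and> head D (as ! e) \<notin> set ps then 1 else 0)"
    and "in_count ps v (take (Suc e) as) = in_count ps v (take e as) +
           (if head D (as ! e) = v \<and> tail D (as ! e) \<in> set ps then 1 else 0)"
  using assms by (simp_all add: out_count_def in_count_def take_Suc_conv_app_nth)

lemma eligible_iff:
  assumes "v \<in> verts D"
  shows "eligible D g f ps v \<longleftrightarrow> v \<notin> set ps \<and>
    (bound_code (g v) = 0 \<or> out_count ps v as < bound_code (g v)) \<and>
    bound_code (f v) < in_count ps v as + 2"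
proof -
  have "card {e \<in> out_arcs D v. head D e \<notin> set ps} = out_count ps v as"
    using distinct_card[of "filter (\<lambda>e. tail D e = v \<and> head D e \<notin> set ps) as"] as
    by (simp add: out_count_def out_arcs_def conj_assoc)
  moreover have "card {e \<in> in_arcs D v. tail D e \<in> set ps} = in_count ps v as"
    using distinct_card[of "filter (\<lambda>e. head D e = v \<and> tail D e \<in> set ps) as"] as
    by (simp add: in_count_def in_arcs_def conj_assoc)
  ultimately show ?thesis
    using assms g[OF assms] f[OF assms]
    by (cases "g v"; cases "f v") (auto simp: eligible_def)
qed

lemma scan_arc_triple:
  assumes "j < n" "e < m"
  shows "triple N (arc_state ps k j e) scan_arc (arc_state ps k j (Suc e))"
proof -
  note le = count_le[of ps "vs ! j" "Suc e", unfolded count_Suc[OF assms(2)]]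
  show ?thesis
    using assms le
    by (intro triple_straight)
      (auto simp: scan_arc_def arc_state_def state_def count_Suc intro!: bit_size_small)
qed

lemma count_arcs_triple:
  assumes "j < n"
  shows "triple N (state ps k j) count_arcs (arc_state ps k j m)"
  unfolding count_arcs_def
proof (rule triple_Seq)
  show "triple N (arc_state ps k j 0) (While (Less e_exp m_exp) scan_arc) (arc_state ps k j m)"
    by (rule triple_While[where I = "arc_state ps k j"])
      (use scan_arc_triple[OF assms] m_le in \<open>auto simp: arc_state_def state_def\<close>)
qed (rule triple_straight,
    auto simp: arc_state_def state_def out_count_def in_count_def intro!: bit_size_small)

lemma eligible_test_iff:
  assumes "arc_state ps k j m M" "j < n"
  shows "bval M eligible_test \<longleftrightarrow> eligible D g f ps (vs ! j)"
proof -
  have "vs ! j \<in> verts D" using nth_mem[OF assms(2)] vs(2) by simp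
  moreover have "M 0 = input" "M 2 = (\<lambda>v. if v \<in> set ps then 1 else 0)" "M 5 0 = j"
      "M 7 0 = out_count ps (vs ! j) as" "M 8 0 = in_count ps (vs ! j) as"
    using assms(1) by (simp_all add: arc_state_def state_def)
  ultimately show ?thesis
    using assms(2) by (simp add: eligible_iff eligible_test_def)
qed

lemma greedy_suffix_length:
  assumes "greedy_suffix D g f ps"
  shows "length ps \<le> n"
  using greedy_suffix_distinct[OF assms] vs
  by (metis List.finite_set card_mono distinct_card)

lemma visit_vertex_triple:
  assumes j: "j < n" and ps: "greedy_suffix D g f ps"
  shows "triple N (state ps k j) visit_vertex
           (state (prepend_if_eligible D g f (vs ! j) ps) k (Suc j))"
  unfolding visit_vertex_def
proof (rule triple_Seq[OF _ count_arcs_triple[OF j]], rule triple_straight)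
  fix M assume bounded: "mem_bounded N M" and M: "arc_state ps k j m M"
  let ?v = "vs ! j"
  let ?Q = "state (prepend_if_eligible D g f ?v ps) k (Suc j)"
  have small: "bit_size (Suc 0) \<le> N" "bit_size (Suc j) \<le> N"
      "bit_size (n - length ps - Suc 0) \<le> N"
    using j by (auto intro!: bit_size_small)
  show "wp N (Seq (Cond eligible_test place_vertex Skip)
           (Store 5 (Const 0) (Plus j_exp (Const 1)))) ?Q M"
  proof (cases "eligible D g f ps ?v")
    case True
    have len: "length ps < n" using greedy_suffix_length[of "?v # ps"] ps True by simp
    have "M 0 (3 + j) = ?v"
      using M input_layout(3)[OF j] by (simp only: arc_state_def state_def)
    moreover have "bit_size (M 0 (3 + j)) \<le> N"
      using bounded by (simp only: mem_bounded_def)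
    ultimately have "bit_size ?v \<le> N" by simp
    with True small M j len show ?thesis
      by (auto simp: eligible_test_iff[OF M j] place_vertex_def arc_state_def state_def
          output_block_Cons)
  next
    case False
    then show ?thesis
      using small M j by (auto simp: eligible_test_iff[OF M j] arc_state_def state_def)
  qed
qed

text \<open>The position \<open>j\<close> that the preceding sweep leaves behind is irrelevant, because a sweep resets it.\<close>

lemma sweep_triple:
  assumes k: "k < n" and ps: "greedy_suffix D g f ps"
  shows "triple N (\<lambda>M. \<exists>j. state ps k j M) sweep
           (\<lambda>M. \<exists>j. state (sweep_list D g f vs ps) (Suc k) j M)"
  unfolding sweep_def
proof (intro triple_Seq)
  let ?I = "\<lambda>j. state (sweep_list D g f (take j vs) ps) k j"
  show "triple N (?I 0) (While (Less j_exp n_exp) visit_vertex) (?I n)"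
  proof (rule triple_While[where I = ?I])
    fix j assume j: "j < n"
    have "sweep_list D g f (take (Suc j) vs) ps =
        prepend_if_eligible D g f (vs ! j) (sweep_list D g f (take j vs) ps)"
      using j by (simp add: take_Suc_conv_app_nth)
    then show "triple N (?I j) visit_vertex (?I (Suc j))"
      using visit_vertex_triple[OF j greedy_suffix_sweep[OF ps]] by simp
  qed (auto simp: state_def n_le)
  show "triple N (\<lambda>M. \<exists>j. state ps k j M) (Store 5 (Const 0) (Const 0)) (?I 0)"
    by (rule triple_straight) (auto simp: state_def intro!: bit_size_small)
  show "triple N (?I n) (Store 4 (Const 0) (Plus k_exp (Const 1)))
      (\<lambda>M. \<exists>j. state (sweep_list D g f vs ps) (Suc k) j M)"
    by (rule triple_straight) (use k in \<open>auto simp: state_def intro!: bit_size_small\<close>)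
qed

text \<open>The result of \<open>n\<close> sweeps, in the form in which the program reports it.\<close>

definition answer :: "nat list" where
  "answer = (let ps = (sweep_list D g f vs ^^ n) [] in if length ps = n then 1 # ps else [0])"

lemma write_answer_triple:
  "triple N (\<lambda>M. \<exists>j. state ((sweep_list D g f vs ^^ n) []) n j M) write_answer
     (\<lambda>M. result_of M = answer)"
proof (rule triple_straight)
  let ?ps = "(sweep_list D g f vs ^^ n) []"
  fix M assume "\<exists>j. state ?ps n j M"
  then obtain j where M: "state ?ps n j M" ..
  have small: "bit_size 0 \<le> N" "bit_size (Suc 0) \<le> N" "bit_size (Suc n) \<le> N"
    by (auto intro!: bit_size_small)
  have "length ?ps \<le> n"
    by (rule greedy_suffix_length[OF greedy_suffix_sweeps])
  then have rest: "M 3 0 = 0 \<longleftrightarrow> length ?ps = n" using M by (auto simp: state_def)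
  have out: "map ((M 1)(0 := Suc n, Suc 0 := Suc 0)) [1..<Suc (Suc n)] = 1 # ?ps"
    if len: "length ?ps = n"
  proof (rule nth_equalityI)
    fix i assume "i < length (map ((M 1)(0 := Suc n, Suc 0 := Suc 0)) [1..<Suc (Suc n)])"
    then have i: "i < Suc n" by (simp del: upt_Suc)
    have "\<forall>i<n. M 1 (2 + i) = ?ps ! i" using M len by (simp add: state_def output_block_def)
    then show "map ((M 1)(0 := Suc n, Suc 0 := Suc 0)) [1..<Suc (Suc n)] ! i = (1 # ?ps) ! i"
      using i by (cases i) (auto simp del: upt_Suc)
  qed (simp add: len del: upt_Suc)
  have none: "map ((M 1)(0 := Suc 0, Suc 0 := 0)) [1..<Suc (Suc 0)] = [0]" by simp
  show "wp N write_answer (\<lambda>M. result_of M = answer) M"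
    using small rest out none M
    by (auto simp: write_answer_def result_of_def answer_def state_def Let_def simp del: upt_Suc)
qed

lemma ordering_program_triple:
  "triple N (\<lambda>M. M = initial_memory xs) ordering_program (\<lambda>M. result_of M = answer)"
  unfolding ordering_program_def
proof (rule triple_Seq[OF write_answer_triple], rule triple_Seq)
  let ?I = "\<lambda>k M. \<exists>j. state ((sweep_list D g f vs ^^ k) []) k j M"
  show "triple N (?I 0) (While (Less k_exp n_exp) sweep) (?I n)"
  proof (rule triple_While[where I = ?I])
    fix k assume "k < n"
    from sweep_triple[OF this greedy_suffix_sweeps]
    show "triple N (?I k) sweep (?I (Suc k))" by simp
  qed (auto simp: state_def n_le)
  have "initial_memory xs k = (\<lambda>_. 0)" if "k > 0" for k
    using that by (auto simp: initial_memory_def)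
  then show "triple N (\<lambda>M. M = initial_memory xs) (Store 3 (Const 0) n_exp) (?I 0)"
    by (intro triple_straight) (auto simp: state_def intro!: bit_size_small)
qed

lemma runs_ordering_program:
  "\<exists>t. runs ordering_program xs t answer \<and> t \<le> poly (time_poly ordering_program) N"
  using tripleD[OF ordering_program_triple mem_bounded_initial refl]
  unfolding runs_def by blast

lemma answer_correct:
  "(\<exists>\<sigma>. answer = 1 # \<sigma> \<and> feasible_ordering D g f \<sigma>) \<or>
   (answer = [0] \<and> \<not> (\<exists>\<sigma>. feasible_ordering D g f \<sigma>))"
  using sweeps_correct[OF finD loopfreeD vs, of g f]
  by (auto simp: answer_def Let_def split: if_splits)

end

theorem theorem2p15:
  shows "\<exists>(P :: com) (p :: nat poly).
    \<forall>(D :: (nat, nat) pre_digraph) (g :: nat \<Rightarrow> nat extended) (f :: nat \<Rightarrow> nat extended) xs.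
      fin_digraph D \<and> loopfree_digraph D \<and>
      (\<forall>v \<in> verts D. g v \<noteq> Minf) \<and> (\<forall>v \<in> verts D. f v \<noteq> Pinf) \<and>
      encodes xs D g f \<longrightarrow>
      (\<exists>t ys. runs P xs t ys \<and> t \<le> poly p (input_size xs) \<and>
         ((\<exists>\<sigma>. ys = 1 # \<sigma> \<and> feasible_ordering D g f \<sigma>) \<or>
          (ys = [0] \<and> \<not> (\<exists>\<sigma>. feasible_ordering D g f \<sigma>))))"
proof (rule exI[of _ ordering_program],
    rule exI[of _ "pcompose (time_poly ordering_program) [:1, 1:]"], intro allI impI, elim conjE)
  fix D :: "(nat, nat) pre_digraph" and g f :: "nat \<Rightarrow> nat extended" and xs
  let ?p = "pcompose (time_poly ordering_program) [:1, 1:]"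
  assume D: "fin_digraph D" "loopfree_digraph D"
    and bounds: "\<forall>v \<in> verts D. g v \<noteq> Minf" "\<forall>v \<in> verts D. f v \<noteq> Pinf"
    and "encodes xs D g f"
  then obtain vs as where vs: "distinct vs" "set vs = verts D"
    and as: "distinct as" "set as = arcs D"
    and xs: "xs = [length vs, length as] @ vs
             @ map (\<lambda>v. bound_code (g v)) vs @ map (\<lambda>v. bound_code (f v)) vs
             @ map (tail D) as @ map (head D) as"
    unfolding encodes_def by blast
  interpret I: encoded_instance D g f vs as
    by (rule encoded_instance.intro) (use D bounds vs as in auto)
  have xs_eq: "xs = I.xs" unfolding I.xs_def by (rule xs)
  obtain t where "runs ordering_program xs t I.answer" "t \<le> poly (time_poly ordering_program) I.N"
    using I.runs_ordering_program unfolding xs_eq by blast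
  moreover have "poly (time_poly ordering_program) I.N = poly ?p (input_size xs)"
    by (simp add: I.N_def xs_eq poly_pcompose add.commute)
  ultimately show "\<exists>t ys. runs ordering_program xs t ys \<and> t \<le> poly ?p (input_size xs) \<and>
         ((\<exists>\<sigma>. ys = 1 # \<sigma> \<and> feasible_ordering D g f \<sigma>) \<or>
          (ys = [0] \<and> \<not> (\<exists>\<sigma>. feasible_ordering D g f \<sigma>)))"
    using I.answer_correct by metis
qed

end
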